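(* Assume that $C$ is a convex closed subset of $\Delta_{\mathcal X}$ with support $\mathcal X$, $\nu\in\Delta_{\mathcal X}$, and $(\nu(\delta))_{\delta>0}$ is a family in $\Delta_{\mathcal X}$ such that $\nu(\delta)>0$ for every $\delta>0$ and $\lim_{\delta\searrow0}\nu(\delta)=\nu$. Then $\ell^C_\delta$ epi-converges to $\ell^C_\nu$ for $\delta\searrow0$. Consequently, $$\lim_{\delta\searrow0}\ \inf_{\hat q_{\mathcal P}\in S_{\mathcal P}}d(\hat q_{\mathcal P}(\delta),\hat q_{\mathcal P})=0$$ and the active coordinates of the solutions of the perturbed problems converge to the unique point $\hat q^a_{\mathcal P}$ of $S^a_{\mathcal P}$: $$\lim_{\delta\searrow0}\hat q^a_{\mathcal P}(\delta)=\hat q^a_{\mathcal P}\in S^a_{\mathcal P}.$$ Moreover, if $S_{\mathcal P}$ is a singleton (particularly, if $\nu>0$), then also the passive coordinates converge and $$\lim_{\delta\searrow0}\hat q_{\mathcal P}(\delta)\in S_{\mathcal P}.$$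
   Context: $\mathcal X$ is a finite nonempty set with $m$ elements; $\mathbb R^m$ is identified with $\mathbb R^{\mathcal X}$. Relations and functions of vectors are componentwise, $\sum x$ is the sum of the coordinates, $\langle\cdot,\cdot\rangle$ the scalar product, $d$ the Euclidean distance. $\Delta_{\mathcal X}=\{q\in\mathbb R^m: q\ge 0,\ \sum q=1\}$. Conventions: $\log 0=-\infty$, $0\cdot(-\infty)=0$. The support of $C$ is $\{i\in\mathcal X:\ q_i>0\text{ for some }q\in C\}$. Active and passive alphabets (with respect to the limit $\nu$): $\mathcal X^a=\{i:\nu_i>0\}$, $\mathcal X^p=\{i:\nu_i=0\}$; $x=(x^a,x^p)$ denotes the corresponding splitting of coordinates and $M^a$ the projection of a set $M$ to the active coordinates. For $\eta\in\Delta_{\mathcal X}$ put $\ell_\eta(q)=-\langle\eta,\log q\rangle$ ($q\in\Delta_{\mathcal X}$), and $\ell_\delta=\ell_{\nu(\delta)}$. Primal problem: $S_{\mathcal P}=\{\hat q\in C:\ell_\nu(\hat q)=\inf_{C}\ell_\nu\}$; it is nonempty and all its elements have the same active projection $\hat q^a_{\mathcal P}$. Perturbed primal problem: minimize $\ell_\delta$ over $C$; it has a unique solution, denoted $\hat q_{\mathcal P}(\delta)$. For a function $f$ and a set $C$, $f^C:\mathbb R^m\to[-\infty,\infty]$ equals $f$ on $C$ and $\infty$ off $C$. Epi-convergence: for $g_n:\mathbb R^m\to[-\infty,\infty]$ put $(\operatorname{e-liminf}_n g_n)(x)=\lim_{\varepsilon\to0+}\liminf_{n\to\infty}\inf_{x'\in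 B(x,\varepsilon)}g_n(x')$ and $(\operatorname{e-limsup}_n g_n)(x)=\lim_{\varepsilon\to0+}\limsup_{n\to\infty}\inf_{x'\in B(x,\varepsilon)}g_n(x')$, where $B(x,\varepsilon)$ is the closed ball. $(g_n)$ epi-converges to $g$ if both equal $g$. A family $(g_\delta)_{\delta>0}$ epi-converges to $g$ for $\delta\searrow0$ if $(g_{\delta_n})_n$ epi-converges to $g$ for every sequence $(\delta_n)_n$ decreasing to zero. *)

theory Defs
  imports "HOL-Analysis.Analysis"
begin

text \<open>The finite alphabet is the index type \<open>'n\<close>, so a vector in \<open>real ^ 'n\<close> has its
  coordinates indexed by the letters.\<close>

definition prob_simplex :: "(real ^ 'n) set" where
  "prob_simplex = {q. (\<forall>i. 0 \<le> q $ i) \<and> (\<Sum>i\<in>UNIV. q $ i) = 1}"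

definition letter_support :: "(real ^ 'n) set \<Rightarrow> 'n set" where
  "letter_support C = {i. \<exists>q\<in>C. q $ i > 0}"

definition active_letters :: "real ^ 'n \<Rightarrow> 'n set" where
  "active_letters \<nu> = {i. \<nu> $ i > 0}"

definition passive_letters :: "real ^ 'n \<Rightarrow> 'n set" where
  "passive_letters \<nu> = {i. \<nu> $ i = 0}"

text \<open>The space of vectors indexed by \<open>A\<close> is identified with the vectors that vanish outside \<open>A\<close>;
  this identification is isometric.\<close>

definition coord_proj :: "'n set \<Rightarrow> real ^ 'n \<Rightarrow> real ^ 'n" where
  "coord_proj A x = (\<chi> i. if i \<in> A then x $ i else 0)"

text \<open>The library's real \<open>ln\<close> satisfies \<open>ln 0 = 0\<close>, whereas here the value at \<open>0\<close> is \<open>-\<infinity>\<close>.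
  Only nonnegative arguments are relevant.\<close>

definition log_ext :: "real \<Rightarrow> ereal" where
  "log_ext x = (if x \<le> 0 then -\<infinity> else ereal (ln x))"

text \<open>In \<^typ>\<open>ereal\<close>, \<open>0 * (-\<infinity>) = 0\<close>. For \<open>\<eta>\<close> and \<open>q\<close> in the simplex no summand is positive,
  so the undetermined form \<open>\<infinity> - \<infinity>\<close> does not occur.\<close>

definition ell :: "real ^ 'n \<Rightarrow> real ^ 'n \<Rightarrow> ereal" where
  "ell \<eta> q = - (\<Sum>i\<in>UNIV. ereal (\<eta> $ i) * log_ext (q $ i))"

definition restrict_top :: "'a set \<Rightarrow> ('a \<Rightarrow> ereal) \<Rightarrow> 'a \<Rightarrow> ereal" where
  "restrict_top C f x = (if x \<in> C then f x else \<infinity>)"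

definition epi_liminf :: "(nat \<Rightarrow> 'a::metric_space \<Rightarrow> ereal) \<Rightarrow> 'a \<Rightarrow> ereal" where
  "epi_liminf g x =
     Lim (at_right (0::real)) (\<lambda>\<epsilon>. liminf (\<lambda>n. INF x'\<in>cball x \<epsilon>. g n x'))"

definition epi_limsup :: "(nat \<Rightarrow> 'a::metric_space \<Rightarrow> ereal) \<Rightarrow> 'a \<Rightarrow> ereal" where
  "epi_limsup g x =
     Lim (at_right (0::real)) (\<lambda>\<epsilon>. limsup (\<lambda>n. INF x'\<in>cball x \<epsilon>. g n x'))"

definition epi_converges :: "(nat \<Rightarrow> 'a::metric_space \<Rightarrow> ereal) \<Rightarrow> ('a \<Rightarrow> ereal) \<Rightarrow> bool" where
  "epi_converges g h \<longleftrightarrow> (\<forall>x. epi_liminf g x = h x \<and> epi_limsup g x = h x)"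

definition epi_converges_at_right_0 ::
    "(real \<Rightarrow> 'a::metric_space \<Rightarrow> ereal) \<Rightarrow> ('a \<Rightarrow> ereal) \<Rightarrow> bool" where
  "epi_converges_at_right_0 g h \<longleftrightarrow>
     (\<forall>\<delta>::nat \<Rightarrow> real. (\<forall>n. \<delta> n > 0) \<and> decseq \<delta> \<and> \<delta> \<longlonglongrightarrow> 0
        \<longrightarrow> epi_converges (\<lambda>n. g (\<delta> n)) h)"

definition primal_solutions :: "(real ^ 'n) set \<Rightarrow> real ^ 'n \<Rightarrow> (real ^ 'n) set" where
  "primal_solutions C \<eta> = {q \<in> C. ell \<eta> q = (INF q'\<in>C. ell \<eta> q')}"

text \<open>The solution for strictly positive \<open>\<eta>\<close>; it is well defined by
  \<open>ex1_primal_solution\<close> below.\<close>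

definition primal_solution :: "(real ^ 'n) set \<Rightarrow> real ^ 'n \<Rightarrow> real ^ 'n" where
  "primal_solution C \<eta> = (THE q. q \<in> primal_solutions C \<eta>)"

lemma ell_pos:
  assumes "\<And>i. q $ i > 0"
  shows "ell \<eta> q = ereal (- (\<Sum>i\<in>UNIV. \<eta> $ i * ln (q $ i)))"
proof -
  have "\<And>i. \<not> q $ i \<le> 0" using assms by (simp add: not_le)
  then show ?thesis by (simp add: ell_def log_ext_def)
qed

lemma ell_zero:
  assumes \<eta>: "\<And>i. \<eta> $ i > 0" and q: "q \<in> prob_simplex" and j: "q $ j = 0"
  shows "ell \<eta> q = \<infinity>"
proof -
  have le1: "q $ i \<le> 1" for i
    using q member_le_sum[of i UNIV "\<lambda>i. q $ i"] by (auto simp: prob_simplex_def)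
  have ne: "ereal (\<eta> $ i) * log_ext (q $ i) \<noteq> \<infinity>" for i
    using \<eta>[of i] by (simp add: log_ext_def)
  have "ereal (\<eta> $ j) * log_ext (q $ j) = -\<infinity>"
    using \<eta>[of j] j by (simp add: log_ext_def)
  then have "(\<Sum>i\<in>UNIV. ereal (\<eta> $ i) * log_ext (q $ i)) = -\<infinity>"
    using ne by (subst sum.remove[of _ j]) (auto simp: sum_Pinfty)
  then show ?thesis by (simp add: ell_def)
qed

lemma positive_element:
  assumes "convex C" "letter_support C = UNIV" "C \<subseteq> prob_simplex"
  shows "\<exists>q\<in>C. \<forall>i. q $ i > (0::real)"
proof -
  have "\<forall>i. \<exists>q\<in>C. q $ i > 0" using assms(2) by (auto simp: letter_support_def)
  then obtain f where f: "\<And>i. f i \<in> C" "\<And>i. f i $ i > 0" by metis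
  let ?c = "1 / real CARD('a)"
  let ?q = "\<Sum>i\<in>UNIV. ?c *\<^sub>R f i"
  have "?q \<in> C"
    by (rule convex_sum) (use assms(1) f in auto)
  moreover have "?q $ j > 0" for j
  proof -
    have "0 \<le> f i $ j" for i using f(1) assms(3) by (auto simp: prob_simplex_def)
    then have "0 < (\<Sum>i\<in>UNIV. ?c * (f i $ j))"
      by (intro sum_pos2[where i=j]) (use f(2) in auto)
    then show ?thesis by simp
  qed
  ultimately show ?thesis by blast
qed

lemma ex1_primal_solution:
  assumes C: "convex C" "closed C" "C \<subseteq> prob_simplex" "letter_support C = UNIV"
    and \<eta>: "\<And>i. \<eta> $ i > 0"
  shows "\<exists>!q. q \<in> primal_solutions C \<eta>"
proof -
  define P where "P = (\<lambda>q::real^'a. \<Prod>i\<in>UNIV. (q $ i) powr (\<eta> $ i))"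
  obtain p where p: "p \<in> C" "\<And>i. p $ i > 0" using positive_element[OF C(1,4,3)] by blast
  have nn: "0 \<le> q $ i" if "q \<in> C" for q i using that C(3) by (auto simp: prob_simplex_def)
  have "norm q \<le> 1" if "q \<in> C" for q
  proof -
    have "norm q \<le> (\<Sum>i\<in>UNIV. \<bar>q $ i\<bar>)" by (rule norm_le_l1_cart)
    also have "\<dots> = (\<Sum>i\<in>UNIV. q $ i)" by (intro sum.cong) (use nn that in auto)
    also have "\<dots> = 1" using that C(3) by (auto simp: prob_simplex_def)
    finally show ?thesis .
  qed
  then have "compact C"
    using C(2) by (auto simp: compact_eq_bounded_closed bounded_iff)
  moreover have "continuous_on C P"
    unfolding P_def
    by (intro continuous_on_prod continuous_on_powr' continuous_intros) (use nn \<eta> in auto)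
  ultimately obtain q where q: "q \<in> C" "\<And>r. r \<in> C \<Longrightarrow> P r \<le> P q"
    using continuous_attains_sup[of C P] p(1) by blast
  have Ppos: "P r > 0" if "\<And>i. r $ i > 0" for r
    unfolding P_def by (intro prod_pos) (simp add: less_imp_neq[OF that, symmetric])
  have Pzero: "r $ i > 0" if "r \<in> C" "P r > 0" for r i
  proof (rule ccontr)
    assume "\<not> r $ i > 0"
    then have "r $ i = 0" using nn[OF that(1), of i] by simp
    then have "P r = 0" unfolding P_def by (intro prod_zero) (auto intro!: bexI[of _ i])
    then show False using that(2) by simp
  qed
  have ellP: "ell \<eta> r = (if P r > 0 then ereal (- ln (P r)) else \<infinity>)" if r: "r \<in> C" for r
  proof (cases "P r > 0")
    case True
    then have pos: "\<And>i. r $ i > 0" using Pzero r by blast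
    have "ln (P r) = (\<Sum>i\<in>UNIV. \<eta> $ i * ln (r $ i))"
      unfolding P_def
      by (subst ln_prod) (auto simp: ln_powr pos less_imp_neq[OF pos, symmetric])
    then show ?thesis using True ell_pos[OF pos] by simp
  next
    case False
    then obtain j where "\<not> r $ j > 0" using Ppos by blast
    then have "r $ j = 0" using nn[OF r, of j] by simp
    then show ?thesis using False ell_zero[OF \<eta>] r C(3) by auto
  qed
  have Pq: "P q > 0" using Ppos[OF p(2)] q(2)[OF p(1)] by simp
  have "ell \<eta> q \<le> ell \<eta> r" if "r \<in> C" for r
    using ellP[OF that] ellP[OF q(1)] Pq q(2)[OF that] by auto
  then have inf: "(INF r\<in>C. ell \<eta> r) = ell \<eta> q"
    using q(1) by (intro antisym INF_lower INF_greatest)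
  show ?thesis
  proof (rule ex1I)
    show "q \<in> primal_solutions C \<eta>" using q(1) inf by (simp add: primal_solutions_def)
  next
    fix r assume "r \<in> primal_solutions C \<eta>"
    then have r: "r \<in> C" "ell \<eta> r = ell \<eta> q" using inf by (auto simp: primal_solutions_def)
    then have Pr: "P r > 0" "P r = P q"
      using ellP[OF r(1)] ellP[OF q(1)] Pq by (auto split: if_splits)
    show "r = q"
    proof (rule ccontr)
      assume "r \<noteq> q"
      then obtain j where j: "r $ j \<noteq> q $ j" by (auto simp: vec_eq_iff)
      define m where "m = (1/2) *\<^sub>R r + (1/2) *\<^sub>R q"
      have mC: "m \<in> C" unfolding m_def using C(1) r(1) q(1) by (intro convexD) auto
      have pos: "r $ i > 0" "q $ i > 0" for i using Pzero r(1) q(1) Pr(1) Pq by auto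
      have m: "m $ i = (r $ i + q $ i) / 2" for i by (simp add: m_def)
      have mpos: "m $ i > 0" for i using pos[of i] by (simp add: m)
      have sq: "(m $ i)\<^sup>2 = r $ i * q $ i + ((r $ i - q $ i) / 2)\<^sup>2" for i
        by (simp add: m power2_eq_square field_simps)
      have P2: "P r * P q = (\<Prod>i\<in>UNIV. (r $ i * q $ i) powr (\<eta> $ i))"
        using pos by (simp add: P_def powr_mult less_imp_le flip: prod.distrib)
      have P3: "P m * P m = (\<Prod>i\<in>UNIV. ((m $ i)\<^sup>2) powr (\<eta> $ i))"
        using mpos by (simp add: P_def powr_mult power2_eq_square less_imp_le flip: prod.distrib)
      have "(\<Prod>i\<in>UNIV. (r $ i * q $ i) powr (\<eta> $ i)) < (\<Prod>i\<in>UNIV. ((m $ i)\<^sup>2) powr (\<eta> $ i))"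
      proof (rule prod_mono_strict[where i = j])
        show "(r $ j * q $ j) powr (\<eta> $ j) < ((m $ j)\<^sup>2) powr (\<eta> $ j)"
          by (rule powr_less_mono2) (use \<eta> pos[of j] j in \<open>auto simp: sq\<close>)
        show "0 \<le> (r $ i * q $ i) powr (\<eta> $ i) \<and>
            (r $ i * q $ i) powr (\<eta> $ i) \<le> ((m $ i)\<^sup>2) powr (\<eta> $ i)" for i
          using \<eta>[of i] pos[of i] by (auto simp: sq intro!: powr_mono2)
        show "0 < ((m $ i)\<^sup>2) powr (\<eta> $ i)" for i using mpos[of i] by simp
      qed auto
      then have "P q * P q < P m * P m" using P2 P3 Pr by simp
      moreover have "P m \<le> P q" by (rule q(2)[OF mC])
      ultimately show False using Ppos[OF mpos] Pq by (smt (verit) mult_mono)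
    qed
  qed
qed

end

theory Submission
  imports Defs
begin

text \<open>
  The idea is that the map \<open>(\<eta>, q) \<mapsto> ell \<eta> q\<close> is jointly lower semicontinuous on
  the product of two simplices: truncating the logarithm from below at \<open>ln e\<close> gives functions that
  are continuous in both arguments, lie below \<open>ell\<close> and have \<open>ell\<close> as their supremum
  (\<open>ell_trunc_le_ell\<close>, \<open>less_ell_trunc\<close>). This is the lower half of epi-convergence. Joint
  continuity fails: a passive letter \<open>i\<close> contributes nothing to the limit function, but
  \<open>- \<nu>(\<delta>)\<^sub>i * ln (q\<^sub>i)\<close> may be large when \<open>q\<^sub>i\<close> is close to \<open>0\<close>. The upper half therefore
  approximates a point \<open>q \<in> C\<close> by points of \<open>C\<close> all of whose coordinates are positive, on the
  segment from \<open>q\<close> to a fixed positive point (\<open>positive_recovery\<close>); at such a point \<open>ell \<eta>\<close> is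
  continuous in \<open>\<eta>\<close>.

  Epi-convergence over a compact set forces minimizers towards minimizers
  (\<open>minimizers_eventually_near_argmin\<close>): a point \<open>x \<in> C\<close> that does not minimize the limit function
  has a neighbourhood on which the perturbed functions are eventually larger than their infimum, and
  finitely many such neighbourhoods cover the part of \<open>C\<close> outside a given open superset of the limit
  solutions. In particular the limit problem has a solution, since otherwise these neighbourhoods
  would cover \<open>C\<close>. Hence every continuous map that is constant on the limit solutions converges along
  the perturbed solutions. The distance to the solution set, the projection to the active letters
  (constant because \<open>ln\<close> is strictly concave) and, if the solution is unique, the identity are
  such maps.
\<close>

section \<open>The objective function\<close>

lemma prob_simplex_nonneg: "q \<in> prob_simplex \<Longrightarrow> 0 \<le> q $ i"
  by (simp add: prob_simplex_def)

lemma prob_simplex_le_1: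
  assumes "q \<in> prob_simplex"
  shows "q $ i \<le> 1"
  using assms member_le_sum[of i UNIV "\<lambda>i. q $ i"] by (auto simp: prob_simplex_def)

lemma bounded_prob_simplex: "bounded (prob_simplex :: (real ^ 'n) set)"
proof -
  have "norm q \<le> real CARD('n)" if "q \<in> prob_simplex" for q :: "real ^ 'n"
  proof -
    have "norm q \<le> (\<Sum>i\<in>UNIV. \<bar>q $ i\<bar>)" by (rule norm_le_l1_cart)
    also have "\<dots> \<le> (\<Sum>i\<in>(UNIV :: 'n set). 1)"
      using prob_simplex_nonneg[OF that] prob_simplex_le_1[OF that] by (intro sum_mono) simp
    finally show ?thesis by simp
  qed
  then show ?thesis by (auto simp: bounded_iff)
qed

lemma ell_real:
  assumes "\<And>i. 0 \<le> \<eta> $ i" "\<And>i. \<eta> $ i > 0 \<Longrightarrow> q $ i > 0"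
  shows "ell \<eta> q = ereal (- (\<Sum>i\<in>UNIV. \<eta> $ i * ln (q $ i)))"
proof -
  have "ereal (\<eta> $ i) * log_ext (q $ i) = ereal (\<eta> $ i * ln (q $ i))" for i
  proof (cases "\<eta> $ i = 0")
    case False
    then have "q $ i > 0" using assms by (metis order_le_less)
    then show ?thesis by (simp add: log_ext_def)
  qed (simp flip: zero_ereal_def)
  then show ?thesis by (simp add: ell_def)
qed

lemma ell_infinite:
  assumes "\<And>i. 0 \<le> \<eta> $ i" "\<eta> $ j > 0" "q $ j \<le> 0"
  shows "ell \<eta> q = \<infinity>"
proof -
  have ne: "ereal (\<eta> $ i) * log_ext (q $ i) \<noteq> \<infinity>" for i
    using assms(1)[of i] by (auto simp: log_ext_def)
  have "ereal (\<eta> $ j) * log_ext (q $ j) = -\<infinity>"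
    using assms(2,3) by (simp add: log_ext_def)
  then have "(\<Sum>i\<in>UNIV. ereal (\<eta> $ i) * log_ext (q $ i)) = -\<infinity>"
    using ne by (subst sum.remove[of _ j]) (auto simp: sum_Pinfty)
  then show ?thesis by (simp add: ell_def)
qed

section \<open>Joint lower semicontinuity\<close>

definition ell_trunc :: "real \<Rightarrow> real ^ 'n \<Rightarrow> real ^ 'n \<Rightarrow> real" where
  "ell_trunc e \<eta> q = - (\<Sum>i\<in>UNIV. \<eta> $ i * ln (max (q $ i) e))"

lemma tendsto_ell_trunc:
  assumes "e > 0"
  shows "((\<lambda>(\<eta>, q). ell_trunc e \<eta> q) \<longlongrightarrow> ell_trunc e \<eta>0 q0) (nhds \<eta>0 \<times>\<^sub>F nhds q0)"
proof -
  have "(fst \<longlongrightarrow> \<eta>0) (nhds \<eta>0 \<times>\<^sub>F nhds q0)" "(snd \<longlongrightarrow> q0) (nhds \<eta>0 \<times>\<^sub>F nhds q0)"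
    by (auto intro: filterlim_fst filterlim_snd)
  then show ?thesis
    unfolding ell_trunc_def case_prod_beta
    using assms by (intro tendsto_intros) auto
qed

lemma ell_trunc_le_ell:
  assumes "\<And>i. 0 \<le> \<eta> $ i" "e > 0"
  shows "ereal (ell_trunc e \<eta> q) \<le> ell \<eta> q"
proof -
  have "ereal (\<eta> $ i) * log_ext (q $ i) \<le> ereal (\<eta> $ i * ln (max (q $ i) e))" for i
    using assms(1)[of i] assms(2)
    by (cases "\<eta> $ i = 0") (auto simp: log_ext_def max_def intro!: mult_left_mono simp flip: zero_ereal_def)
  then have "(\<Sum>i\<in>UNIV. ereal (\<eta> $ i) * log_ext (q $ i))
      \<le> (\<Sum>i\<in>UNIV. ereal (\<eta> $ i * ln (max (q $ i) e)))"
    by (intro sum_mono)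
  then have "- (\<Sum>i\<in>UNIV. ereal (\<eta> $ i * ln (max (q $ i) e))) \<le> ell \<eta> q"
    unfolding ell_def by (subst ereal_minus_le_minus)
  then show ?thesis by (simp add: ell_trunc_def)
qed

text \<open>If the active coordinates of \<open>q\<close> are positive, the truncation has no effect for small \<open>e\<close>.
  Otherwise one active letter alone makes the truncated function as large as desired, because the
  other letters contribute nonnegative amounts for \<open>q \<le> 1\<close>.\<close>

lemma less_ell_trunc:
  assumes \<eta>: "\<And>i. 0 \<le> \<eta> $ i" and q: "\<And>i. q $ i \<le> 1" and c: "c < ell \<eta> q"
  shows "\<exists>e>0. c < ereal (ell_trunc e \<eta> q)"
proof (cases "\<forall>i. \<eta> $ i > 0 \<longrightarrow> q $ i > 0")
  case True
  define e where "e = Min (insert 1 ((\<lambda>i. q $ i) ` {i. \<eta> $ i > 0}))"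
  have e: "e > 0" using True by (simp add: e_def)
  have trunc: "\<eta> $ i * ln (max (q $ i) e) = \<eta> $ i * ln (q $ i)" for i
  proof (cases "\<eta> $ i = 0")
    case False
    then have "\<eta> $ i > 0" using \<eta>[of i] by simp
    then have "e \<le> q $ i" unfolding e_def by (intro Min_le) auto
    then show ?thesis by (simp add: max_def)
  qed simp
  have "ereal (ell_trunc e \<eta> q) = ell \<eta> q"
    using ell_real[of \<eta> q] \<eta> True unfolding ell_trunc_def trunc by simp
  then show ?thesis using e c by auto
next
  case False
  then obtain j where j: "\<eta> $ j > 0" "q $ j \<le> 0" by (auto simp: not_less)
  have "c < \<infinity>" using c by (auto intro: less_le_trans)
  then obtain r where r: "r \<ge> 0" "c \<le> ereal r"
    using that[of "max 0 (real_of_ereal c)"] by (cases c) auto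
  \<comment> \<open>the truncation at which the letter \<open>j\<close> contributes exactly \<open>r + 1\<close>\<close>
  define e where "e = exp (- (r + 1) / \<eta> $ j)"
  have e: "0 < e" "e \<le> 1" using r(1) j(1) by (auto simp: e_def divide_nonpos_pos)
  have "\<eta> $ i * ln (max (q $ i) e) \<le> 0" for i
    using \<eta>[of i] q[of i] e by (intro mult_nonneg_nonpos) auto
  then have "(\<Sum>i\<in>UNIV - {j}. \<eta> $ i * ln (max (q $ i) e)) \<le> 0"
    by (intro sum_nonpos)
  moreover have "\<eta> $ j * ln (max (q $ j) e) = - (r + 1)"
  proof -
    have "max (q $ j) e = e" using j(2) e(1) by simp
    then show ?thesis using j(1) by (simp add: e_def)
  qed
  ultimately have "ell_trunc e \<eta> q \<ge> r + 1"
    unfolding ell_trunc_def by (subst sum.remove[of _ j]) auto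
  then have "ereal r < ereal (ell_trunc e \<eta> q)" by simp
  then have "c < ereal (ell_trunc e \<eta> q)" using r(2) by (rule le_less_trans[rotated])
  then show ?thesis using e(1) by blast
qed

text \<open>A supremum of continuous functions is lower semicontinuous. The simplex appears in the
  conclusion because the truncated functions may exceed \<open>ell \<eta>\<close> when \<open>\<eta>\<close> has negative entries.\<close>

lemma ell_lower_semicontinuous:
  assumes "\<eta>0 \<in> prob_simplex" "q0 \<in> prob_simplex" and c: "c < ell \<eta>0 q0"
  shows "\<forall>\<^sub>F (\<eta>, q) in nhds \<eta>0 \<times>\<^sub>F nhds q0. \<eta> \<in> prob_simplex \<longrightarrow> c < ell \<eta> q"
proof -
  obtain e where e: "e > 0" "c < ereal (ell_trunc e \<eta>0 q0)"
    using less_ell_trunc[of \<eta>0 q0 c] assms prob_simplex_nonneg prob_simplex_le_1 by blast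
  have "((\<lambda>x. ereal (case x of (\<eta>, q) \<Rightarrow> ell_trunc e \<eta> q)) \<longlongrightarrow> ereal (ell_trunc e \<eta>0 q0))
      (nhds \<eta>0 \<times>\<^sub>F nhds q0)"
    using tendsto_ell_trunc[OF e(1)] by (intro tendsto_intros)
  from order_tendstoD(1)[OF this e(2)] show ?thesis
  proof (rule eventually_mono)
    fix x assume *: "c < ereal (case x of (\<eta>, q) \<Rightarrow> ell_trunc e \<eta> q)"
    show "case x of (\<eta>, q) \<Rightarrow> \<eta> \<in> prob_simplex \<longrightarrow> c < ell \<eta> q"
    proof (clarify)
      fix \<eta> q assume "x = (\<eta>, q)" "\<eta> \<in> prob_simplex"
      then show "c < ell \<eta> q"
        using * ell_trunc_le_ell[OF prob_simplex_nonneg e(1)] by (force intro: less_le_trans)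
    qed
  qed
qed

lemma perturbed_ell_lower_bound:
  assumes \<nu>: "(\<nu> \<longlongrightarrow> \<nu>0) F" "\<forall>\<^sub>F d in F. \<nu> d \<in> prob_simplex"
    and "\<nu>0 \<in> prob_simplex" "q0 \<in> prob_simplex" "c < ell \<nu>0 q0"
  shows "\<exists>V. open V \<and> q0 \<in> V \<and> (\<forall>\<^sub>F d in F. \<forall>q\<in>V. c < ell (\<nu> d) q)"
proof -
  obtain P Q where P: "eventually P (nhds \<nu>0)" and Q: "eventually Q (nhds q0)"
    and PQ: "\<And>\<eta> q. P \<eta> \<Longrightarrow> Q q \<Longrightarrow> \<eta> \<in> prob_simplex \<longrightarrow> c < ell \<eta> q"
    using ell_lower_semicontinuous[OF assms(3-5)] unfolding eventually_prod_filter by auto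
  obtain V where V: "open V" "q0 \<in> V" "\<forall>q\<in>V. Q q"
    using Q unfolding eventually_nhds by auto
  have "\<forall>\<^sub>F d in F. P (\<nu> d)" using \<nu>(1) P by (rule eventually_compose_filterlim[rotated])
  with \<nu>(2) have "\<forall>\<^sub>F d in F. \<forall>q\<in>V. c < ell (\<nu> d) q"
    by eventually_elim (use V(3) PQ in blast)
  then show ?thesis using V by blast
qed

section \<open>Recovery points\<close>

text \<open>On the segment from \<open>y\<close> to a positive point \<open>p\<close> of \<open>C\<close> all points except \<open>y\<close> have positive
  coordinates. Along it \<open>ell \<eta>\<close> is continuous at \<open>y\<close>, because the letters with
  \<open>y\<^sub>i = 0\<close> have weight \<open>0\<close> when \<open>ell \<eta> y\<close> is finite.\<close>

lemma positive_recovery: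
  assumes C: "convex C" "C \<subseteq> prob_simplex" "letter_support C = UNIV"
    and \<eta>: "\<And>i. 0 \<le> \<eta> $ i" and y: "y \<in> C" "ell \<eta> y < c" and e: "e > 0"
  shows "\<exists>q\<in>C. (\<forall>i. q $ i > 0) \<and> dist y q < e \<and> ell \<eta> q < c"
proof -
  obtain p where p: "p \<in> C" "\<And>i. p $ i > 0" using positive_element[OF C(1,3,2)] by blast
  define q where "q t = (1 - t) *\<^sub>R y + t *\<^sub>R p" for t :: real
  have q_tendsto: "(q \<longlongrightarrow> y) (at_right 0)"
    unfolding q_def by (auto intro!: tendsto_eq_intros)
  have y_nonneg: "y $ i \<ge> 0" for i using y(1) C(2) prob_simplex_nonneg by blast
  have t: "\<forall>\<^sub>F t in at_right 0. 0 < t \<and> t < (1::real)"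
    using eventually_at_right_less[of "0::real"] order_tendstoD(2)[OF tendsto_ident_at zero_less_one]
    by eventually_elim simp
  have pos: "q t $ i > 0" if "0 < t" "t < 1" for t i
    using that y_nonneg[of i] p(2)[of i] by (auto simp: q_def intro!: add_nonneg_pos)
  have y_pos: "y $ i > 0" if "\<eta> $ i > 0" for i
    using ell_infinite[OF \<eta> that] y(2) not_le by force
  have "((\<lambda>t. \<eta> $ i * ln (q t $ i)) \<longlongrightarrow> \<eta> $ i * ln (y $ i)) (at_right 0)" for i
  proof (cases "\<eta> $ i = 0")
    case False
    then have "y $ i \<noteq> 0" using y_pos[of i] \<eta>[of i] by force
    then show ?thesis by (intro tendsto_intros q_tendsto) auto
  qed simp
  then have "((\<lambda>t. \<Sum>i\<in>UNIV. \<eta> $ i * ln (q t $ i)) \<longlongrightarrow> (\<Sum>i\<in>UNIV. \<eta> $ i * ln (y $ i))) (at_right 0)"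
    by (rule tendsto_sum)
  moreover have "ell \<eta> y = ereal (- (\<Sum>i\<in>UNIV. \<eta> $ i * ln (y $ i)))"
    by (rule ell_real[OF \<eta> y_pos])
  ultimately have "((\<lambda>t. ereal (- (\<Sum>i\<in>UNIV. \<eta> $ i * ln (q t $ i)))) \<longlongrightarrow> ell \<eta> y) (at_right 0)"
    by (simp add: tendsto_minus)
  from order_tendstoD(2)[OF this y(2)] t have "\<forall>\<^sub>F t in at_right 0. ell \<eta> (q t) < c"
    by eventually_elim (simp add: ell_pos pos)
  moreover have "\<forall>\<^sub>F t in at_right 0. dist (q t) y < e" using q_tendsto e by (rule tendstoD)
  ultimately have "\<forall>\<^sub>F t in at_right 0. (0 < t \<and> t < 1) \<and> dist (q t) y < e \<and> ell \<eta> (q t) < c"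
    using t by eventually_elim simp
  then obtain s where s: "0 < s" "s < 1" "dist (q s) y < e" "ell \<eta> (q s) < c"
    using eventually_happens'[OF trivial_limit_at_right_real] by blast
  have "q s \<in> C" unfolding q_def using C(1) y(1) p(1) s(1,2) by (intro convexD) auto
  then show ?thesis using s pos[OF s(1,2)] by (auto simp: dist_commute intro!: bexI[of _ "q s"])
qed

lemma perturbed_ell_upper_bound:
  assumes "(\<nu> \<longlongrightarrow> \<nu>0) F" and q: "\<And>i. q $ i > 0" and "ell \<nu>0 q < c"
  shows "\<forall>\<^sub>F d in F. ell (\<nu> d) q < c"
proof -
  have "((\<lambda>d. ell (\<nu> d) q) \<longlongrightarrow> ell \<nu>0 q) F"
    unfolding ell_pos[OF q] using assms(1) by (intro tendsto_intros)
  then show ?thesis using assms(3) by (rule order_tendstoD(2))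
qed

section \<open>Epi-convergence\<close>

text \<open>The second condition keeps both inner limits at most \<open>h x\<close> for every radius, because a nearby
  point with a small value bounds the infimum over the ball. The first one makes them exceed any
  \<open>c < h x\<close> once the ball fits into \<open>V\<close>. So both outer limits exist and equal \<open>h x\<close>.\<close>

lemma epi_convergesI:
  assumes lower: "\<And>x c. c < h x \<Longrightarrow>
        \<exists>V. open V \<and> x \<in> V \<and> (\<forall>\<^sub>F n in sequentially. \<forall>y\<in>V. c < g n y)"
    and upper: "\<And>x c e. h x < c \<Longrightarrow> 0 < e \<Longrightarrow>
        \<forall>\<^sub>F n in sequentially. \<exists>y\<in>cball x e. g n y < c"
  shows "epi_converges g h"
  unfolding epi_converges_def
proof
  fix x
  define I where "I e n = (INF y\<in>cball x e. g n y)" for e n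
  have limsup_le: "limsup (I e) \<le> h x" if e: "e > 0" for e
  proof (rule dense_ge)
    fix c assume "h x < c"
    from upper[OF this e] have "\<forall>\<^sub>F n in sequentially. I e n \<le> c"
      by eventually_elim (auto simp: I_def intro: INF_lower2 less_imp_le)
    then show "limsup (I e) \<le> c" by (rule Limsup_bounded)
  qed
  have le_liminf: "\<forall>\<^sub>F e in at_right 0. c < liminf (I e)" if c: "c < h x" for c
  proof -
    obtain c' where c': "c < c'" "c' < h x" using dense[OF c] by blast
    obtain V where V: "open V" "x \<in> V" "\<forall>\<^sub>F n in sequentially. \<forall>y\<in>V. c' < g n y"
      using lower[OF c'(2)] by blast
    obtain r where r: "r > 0" "cball x r \<subseteq> V" using V(1,2) open_contains_cball by blast
    have "c < liminf (I e)" if "e < r" for e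
    proof -
      have sub: "cball x e \<subseteq> V" using r(2) that by auto
      have "\<forall>\<^sub>F n in sequentially. c' \<le> I e n"
        using V(3)
      proof eventually_elim
        case (elim n)
        show ?case
          unfolding I_def by (rule INF_greatest) (use elim sub in \<open>meson less_imp_le subsetD\<close>)
      qed
      then have "c' \<le> liminf (I e)" by (rule Liminf_bounded)
      then show ?thesis using c'(1) by simp
    qed
    moreover have "\<forall>\<^sub>F e in at_right 0. e < r"
      using r(1) by (intro order_tendstoD(2)[OF tendsto_ident_at])
    ultimately show ?thesis by (auto elim: eventually_mono)
  qed
  have pos: "\<forall>\<^sub>F e in at_right 0. (0::real) < e" by (rule eventually_at_right_less)
  have liminf_le: "liminf (I e) \<le> limsup (I e)" for e by (rule Liminf_le_Limsup) simp
  have "((\<lambda>e. liminf (I e)) \<longlongrightarrow> h x) (at_right 0)"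
  proof (rule order_tendstoI)
    show "\<forall>\<^sub>F e in at_right 0. liminf (I e) < c" if "h x < c" for c
      using pos by eventually_elim (use limsup_le liminf_le that in \<open>meson le_less_trans\<close>)
  qed (rule le_liminf)
  moreover have "((\<lambda>e. limsup (I e)) \<longlongrightarrow> h x) (at_right 0)"
  proof (rule order_tendstoI)
    show "\<forall>\<^sub>F e in at_right 0. limsup (I e) < c" if "h x < c" for c
      using pos by eventually_elim (use limsup_le that in \<open>meson le_less_trans\<close>)
    show "\<forall>\<^sub>F e in at_right 0. c < limsup (I e)" if "c < h x" for c
      using le_liminf[OF that] by eventually_elim (rule less_le_trans[OF _ liminf_le])
  qed
  ultimately show "epi_liminf g x = h x \<and> epi_limsup g x = h x"
    unfolding epi_liminf_def epi_limsup_def I_def by (auto intro!: tendsto_Lim)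
qed

lemma epi_converges_restrict_ell:
  assumes C: "convex C" "closed C" "C \<subseteq> prob_simplex" "letter_support C = UNIV"
    and \<nu>0: "\<nu>0 \<in> prob_simplex" and \<nu>: "\<nu> \<longlonglongrightarrow> \<nu>0" "\<And>n. \<nu> n \<in> prob_simplex"
  shows "epi_converges (\<lambda>n. restrict_top C (ell (\<nu> n))) (restrict_top C (ell \<nu>0))"
proof (rule epi_convergesI)
  fix x c assume c: "c < restrict_top C (ell \<nu>0) x"
  show "\<exists>V. open V \<and> x \<in> V \<and> (\<forall>\<^sub>F n in sequentially. \<forall>y\<in>V. c < restrict_top C (ell (\<nu> n)) y)"
  proof (cases "x \<in> C")
    case True
    then obtain V where V: "open V" "x \<in> V" "\<forall>\<^sub>F n in sequentially. \<forall>y\<in>V. c < ell (\<nu> n) y"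
      using perturbed_ell_lower_bound[OF \<nu>(1) _ \<nu>0, of x c] \<nu>(2) C(3) c
      by (auto simp: restrict_top_def)
    have "c < \<infinity>" using c by (auto intro: less_le_trans)
    then have "\<forall>\<^sub>F n in sequentially. \<forall>y\<in>V. c < restrict_top C (ell (\<nu> n)) y"
      using V(3) by (auto simp: restrict_top_def elim!: eventually_mono)
    then show ?thesis using V by blast
  next
    case False
    then show ?thesis using C(2) c
      by (intro exI[of _ "- C"]) (auto simp: restrict_top_def)
  qed
next
  fix x c and e :: real
  assume c: "restrict_top C (ell \<nu>0) x < c" and e: "0 < e"
  then have "x \<in> C" "ell \<nu>0 x < c" by (auto simp: restrict_top_def split: if_splits)
  then obtain q where q: "q \<in> C" "\<And>i. q $ i > 0" "dist x q < e" "ell \<nu>0 q < c"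
    using positive_recovery[OF C(1,3,4) prob_simplex_nonneg[OF \<nu>0] _ _ e] by blast
  from perturbed_ell_upper_bound[OF \<nu>(1) q(2,4)]
  show "\<forall>\<^sub>F n in sequentially. \<exists>y\<in>cball x e. restrict_top C (ell (\<nu> n)) y < c"
    by eventually_elim (use q(1,3) in \<open>auto simp: restrict_top_def intro!: bexI[of _ q]\<close>)
qed

section \<open>Convergence of minimizers\<close>

text \<open>If \<open>x \<in> C\<close> does not minimize \<open>h\<close>, then a constant \<open>c\<close> strictly between the infimum of \<open>h\<close> and
  \<open>h x\<close> eventually exceeds the infimum of \<open>g d\<close>, while \<open>g d\<close> stays above \<open>c\<close> on a neighbourhood of
  \<open>x\<close>; so \<open>z d\<close> is eventually outside that neighbourhood.\<close>

lemma minimizers_eventually_near_argmin: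
  fixes g :: "'d \<Rightarrow> 'a::topological_space \<Rightarrow> 'b::{complete_linorder, dense_linorder}"
  assumes C: "compact C"
    and lower: "\<And>x c. x \<in> C \<Longrightarrow> c < h x \<Longrightarrow>
        \<exists>V. open V \<and> x \<in> V \<and> (\<forall>\<^sub>F d in F. \<forall>y\<in>V. c < g d y)"
    and upper: "\<And>x c. x \<in> C \<Longrightarrow> h x < c \<Longrightarrow> \<forall>\<^sub>F d in F. \<exists>y\<in>C. g d y < c"
    and z: "\<forall>\<^sub>F d in F. z d \<in> C \<and> g d (z d) = (INF y\<in>C. g d y)"
    and U: "open U" "\<And>x. x \<in> C \<Longrightarrow> h x = (INF y\<in>C. h y) \<Longrightarrow> x \<in> U"
  shows "\<forall>\<^sub>F d in F. z d \<in> U"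
proof -
  have "\<exists>V. open V \<and> x \<in> V \<and> (\<forall>\<^sub>F d in F. z d \<notin> V)" if x: "x \<in> C - U" for x
  proof -
    have "(INF y\<in>C. h y) < h x"
      using x U(2)[of x] INF_lower[of x C h] by (auto simp: order_less_le)
    then obtain c where c: "(INF y\<in>C. h y) < c" "c < h x" using dense by blast
    obtain y where y: "y \<in> C" "h y < c" using c(1) by (auto simp: INF_less_iff)
    obtain V where V: "open V" "x \<in> V" "\<forall>\<^sub>F d in F. \<forall>y\<in>V. c < g d y"
      using lower[OF _ c(2)] x by blast
    from upper[OF y] z V(3) have "\<forall>\<^sub>F d in F. z d \<notin> V"
    proof eventually_elim
      case (elim d)
      then have "g d (z d) < c" by (metis INF_lower le_less_trans)
      then show ?case using elim(3) by auto
    qed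
    then show ?thesis using V by blast
  qed
  then obtain V where V: "\<And>x. x \<in> C - U \<Longrightarrow> open (V x)" "\<And>x. x \<in> C - U \<Longrightarrow> x \<in> V x"
    "\<And>x. x \<in> C - U \<Longrightarrow> \<forall>\<^sub>F d in F. z d \<notin> V x"
    by metis
  have "compact (C - U)" using C U(1) by (rule compact_diff)
  then obtain D where D: "D \<subseteq> C - U" "finite D" "C - U \<subseteq> (\<Union>x\<in>D. V x)"
    by (rule compactE_image[of _ "C - U" V]) (use V(1,2) in auto)
  have "\<forall>\<^sub>F d in F. \<forall>x\<in>D. z d \<notin> V x"
    using D V(3) by (intro eventually_ball_finite) auto
  with z show ?thesis by eventually_elim (use D(3) in auto)
qed

lemma primal_solution_eventually_near:
  assumes C: "convex C" "closed C" "C \<subseteq> prob_simplex" "letter_support C = UNIV"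
    and \<nu>0: "\<nu>0 \<in> prob_simplex"
    and \<nu>: "(\<nu> \<longlongrightarrow> \<nu>0) F" "\<forall>\<^sub>F d in F. \<nu> d \<in> prob_simplex \<and> (\<forall>i. \<nu> d $ i > 0)"
    and U: "open U" "primal_solutions C \<nu>0 \<subseteq> U"
  shows "\<forall>\<^sub>F d in F. primal_solution C (\<nu> d) \<in> U"
proof (rule minimizers_eventually_near_argmin[where h = "ell \<nu>0"])
  show "compact C"
    using C(2) bounded_subset[OF bounded_prob_simplex C(3)] by (simp add: compact_eq_bounded_closed)
  show "\<exists>V. open V \<and> x \<in> V \<and> (\<forall>\<^sub>F d in F. \<forall>y\<in>V. c < ell (\<nu> d) y)"
    if "x \<in> C" "c < ell \<nu>0 x" for x c
  proof (rule perturbed_ell_lower_bound[OF \<nu>(1) _ \<nu>0 _ that(2)])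
    show "\<forall>\<^sub>F d in F. \<nu> d \<in> prob_simplex" using \<nu>(2) by (rule eventually_mono) simp
    show "x \<in> prob_simplex" using that(1) C(3) by blast
  qed
  show "\<forall>\<^sub>F d in F. \<exists>y\<in>C. ell (\<nu> d) y < c" if x: "x \<in> C" "ell \<nu>0 x < c" for x c
  proof -
    obtain q where q: "q \<in> C" "\<And>i. q $ i > 0" "ell \<nu>0 q < c"
      using positive_recovery[OF C(1,3,4) prob_simplex_nonneg[OF \<nu>0] x zero_less_one] by blast
    from perturbed_ell_upper_bound[OF \<nu>(1) q(2,3)] show ?thesis
      by eventually_elim (use q(1) in auto)
  qed
  show "\<forall>\<^sub>F d in F. primal_solution C (\<nu> d) \<in> C
      \<and> ell (\<nu> d) (primal_solution C (\<nu> d)) = (INF q\<in>C. ell (\<nu> d) q)"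
    using \<nu>(2)
  proof eventually_elim
    case (elim d)
    then have "\<exists>!q. q \<in> primal_solutions C (\<nu> d)" by (intro ex1_primal_solution C) auto
    then have "primal_solution C (\<nu> d) \<in> primal_solutions C (\<nu> d)"
      unfolding primal_solution_def by (rule theI')
    then show ?case by (simp add: primal_solutions_def)
  qed
  show "x \<in> U" if "x \<in> C" "ell \<nu>0 x = (INF y\<in>C. ell \<nu>0 y)" for x
    using U(2) that by (auto simp: primal_solutions_def)
qed (rule U(1))

lemma tendsto_primal_solution:
  assumes "convex C" "closed C" "C \<subseteq> prob_simplex" "letter_support C = UNIV"
    and "\<nu>0 \<in> prob_simplex"
    and "(\<nu> \<longlongrightarrow> \<nu>0) F" "\<forall>\<^sub>F d in F. \<nu> d \<in> prob_simplex \<and> (\<forall>i. \<nu> d $ i > 0)"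
    and f: "continuous_on UNIV f" "\<And>q. q \<in> primal_solutions C \<nu>0 \<Longrightarrow> f q = a"
  shows "((\<lambda>d. f (primal_solution C (\<nu> d))) \<longlongrightarrow> a) F"
proof (rule topological_tendstoI)
  fix W assume W: "open W" "a \<in> W"
  have "\<forall>\<^sub>F d in F. primal_solution C (\<nu> d) \<in> f -` W"
    using assms(1-7)
  proof (rule primal_solution_eventually_near)
    show "open (f -` W)" using W(1) f(1) by (rule open_vimage)
    show "primal_solutions C \<nu>0 \<subseteq> f -` W" using f(2) W(2) by auto
  qed
  then show "\<forall>\<^sub>F d in F. f (primal_solution C (\<nu> d)) \<in> W" by simp
qed

section \<open>Solutions of the limit problem\<close>

text \<open>If there were no limit solution, the empty set would be an open superset of the solution set
  and would have to contain the perturbed solutions.\<close>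

lemma primal_solutions_nonempty:
  assumes "convex C" "closed C" "C \<subseteq> prob_simplex" "letter_support C = UNIV"
    and "\<nu>0 \<in> prob_simplex" "F \<noteq> bot"
    and "(\<nu> \<longlongrightarrow> \<nu>0) F" "\<forall>\<^sub>F d in F. \<nu> d \<in> prob_simplex \<and> (\<forall>i. \<nu> d $ i > 0)"
  shows "primal_solutions C \<nu>0 \<noteq> {}"
  using primal_solution_eventually_near[OF assms(1-5,7,8) open_empty] assms(6)
  by (auto simp: trivial_limit_def)

lemma ln_midpoint:
  fixes a b :: real
  assumes "a > 0" "b > 0"
  shows "ln a + ln b \<le> 2 * ln ((a + b) / 2)"
    and "a \<noteq> b \<Longrightarrow> ln a + ln b < 2 * ln ((a + b) / 2)"
proof -
  have sq: "((a + b) / 2)\<^sup>2 = a * b + ((a - b) / 2)\<^sup>2"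
    by (simp add: power2_eq_square field_simps)
  have ab: "ln a + ln b = ln (a * b)" using assms by (simp add: ln_mult)
  have m: "2 * ln ((a + b) / 2) = ln (((a + b) / 2)\<^sup>2)" using assms by (simp add: ln_realpow)
  show "ln a + ln b \<le> 2 * ln ((a + b) / 2)" unfolding ab m sq using assms by (simp add: add_pos_nonneg)
  show "a \<noteq> b \<Longrightarrow> ln a + ln b < 2 * ln ((a + b) / 2)" unfolding ab m sq using assms
    by (simp add: add_pos_pos)
qed

text \<open>If \<open>q\<close> and \<open>r\<close> differed at an active letter, strict concavity of \<open>ln\<close> would make the objective
  smaller at their midpoint than at \<open>q\<close> and \<open>r\<close>.\<close>

lemma primal_solutions_active_unique:
  assumes C: "convex C" and \<eta>: "\<And>i. 0 \<le> \<eta> $ i"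
    and q: "q \<in> primal_solutions C \<eta>" and r: "r \<in> primal_solutions C \<eta>"
    and fin: "ell \<eta> q < \<infinity>" and j: "\<eta> $ j > 0"
  shows "q $ j = r $ j"
proof (rule ccontr)
  assume ne: "q $ j \<noteq> r $ j"
  have qr: "ell \<eta> r = ell \<eta> q" using q r by (simp add: primal_solutions_def)
  have pos: "q $ i > 0" "r $ i > 0" if "\<eta> $ i > 0" for i
    using ell_infinite[OF \<eta> that, of q] ell_infinite[OF \<eta> that, of r] fin qr
    by (auto simp: not_less[symmetric])
  define m where "m = (1/2) *\<^sub>R q + (1/2) *\<^sub>R r"
  have m: "m $ i = (q $ i + r $ i) / 2" for i by (simp add: m_def)
  have "m \<in> C"
    unfolding m_def using C q r by (intro convexD) (auto simp: primal_solutions_def)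
  then have le: "ell \<eta> q \<le> ell \<eta> m" using q by (auto simp: primal_solutions_def intro: INF_lower)
  have mpos: "m $ i > 0" if "\<eta> $ i > 0" for i using pos[OF that] by (simp add: m)
  have "(\<Sum>i\<in>UNIV. \<eta> $ i * (ln (q $ i) + ln (r $ i))) < (\<Sum>i\<in>UNIV. \<eta> $ i * (2 * ln (m $ i)))"
  proof (rule sum_strict_mono_ex1)
    show "\<exists>i\<in>UNIV. \<eta> $ i * (ln (q $ i) + ln (r $ i)) < \<eta> $ i * (2 * ln (m $ i))"
      using ln_midpoint(2)[OF pos[OF j] ne] j by (intro bexI[of _ j]) (simp_all add: m)
    show "\<forall>i\<in>UNIV. \<eta> $ i * (ln (q $ i) + ln (r $ i)) \<le> \<eta> $ i * (2 * ln (m $ i))"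
    proof
      fix i
      show "\<eta> $ i * (ln (q $ i) + ln (r $ i)) \<le> \<eta> $ i * (2 * ln (m $ i))"
        using ln_midpoint(1)[OF pos] \<eta>[of i] by (cases "\<eta> $ i = 0") (auto simp: m)
    qed
  qed simp
  also have "\<dots> = 2 * (\<Sum>i\<in>UNIV. \<eta> $ i * ln (m $ i))"
    by (simp add: sum_distrib_left mult_ac)
  finally have "(\<Sum>i\<in>UNIV. \<eta> $ i * ln (q $ i)) + (\<Sum>i\<in>UNIV. \<eta> $ i * ln (r $ i))
      < 2 * (\<Sum>i\<in>UNIV. \<eta> $ i * ln (m $ i))"
    by (simp add: distrib_left sum.distrib)
  then show False
    using le qr ell_real[OF \<eta> pos(1)] ell_real[OF \<eta> pos(2)] ell_real[OF \<eta> mpos] by simp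
qed

lemma primal_solutions_ell_finite:
  assumes C: "convex C" "C \<subseteq> prob_simplex" "letter_support C = UNIV" and q: "q \<in> primal_solutions C \<eta>"
  shows "ell \<eta> q < \<infinity>"
proof -
  obtain p where p: "p \<in> C" "\<And>i. p $ i > 0" using positive_element[OF C(1,3,2)] by blast
  have "ell \<eta> q \<le> ell \<eta> p"
    using q p(1) by (auto simp: primal_solutions_def intro: INF_lower)
  also have "\<dots> < \<infinity>" using ell_pos[OF p(2)] by simp
  finally show ?thesis .
qed

lemma continuous_on_coord_proj: "continuous_on S (coord_proj A :: real ^ 'n \<Rightarrow> real ^ 'n)"
  unfolding coord_proj_def
proof (rule continuous_on_vec_lambda)
  show "continuous_on S (\<lambda>x :: real ^ 'n. if i \<in> A then x $ i else 0)" for i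
    by (cases "i \<in> A") (auto intro: continuous_intros)
qed


theorem theorem20:
  fixes C :: "(real ^ 'n) set" and \<nu>0 :: "real ^ 'n" and \<nu> :: "real \<Rightarrow> real ^ 'n"
  assumes "convex C" and "closed C" and "C \<subseteq> prob_simplex" and "letter_support C = UNIV"
    and "\<nu>0 \<in> prob_simplex"
    and "\<And>\<delta>. \<delta> > 0 \<Longrightarrow> \<nu> \<delta> \<in> prob_simplex"
    and "\<And>\<delta> i. \<delta> > 0 \<Longrightarrow> \<nu> \<delta> $ i > 0"
    and "(\<nu> \<longlongrightarrow> \<nu>0) (at_right 0)"
  shows
    "epi_converges_at_right_0 (\<lambda>\<delta>. restrict_top C (ell (\<nu> \<delta>))) (restrict_top C (ell \<nu>0))
     \<and> ((\<lambda>\<delta>. INF q\<in>primal_solutions C \<nu>0. dist (primal_solution C (\<nu> \<delta>)) q)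
          \<longlongrightarrow> (0::real)) (at_right 0)
     \<and> (\<exists>qa. coord_proj (active_letters \<nu>0) ` primal_solutions C \<nu>0 = {qa}
          \<and> ((\<lambda>\<delta>. coord_proj (active_letters \<nu>0) (primal_solution C (\<nu> \<delta>))) \<longlongrightarrow> qa) (at_right 0))
     \<and> ((\<forall>i. \<nu>0 $ i > 0) \<longrightarrow> is_singleton (primal_solutions C \<nu>0))
     \<and> (is_singleton (primal_solutions C \<nu>0) \<longrightarrow>
          (\<exists>qp. ((\<lambda>\<delta>. coord_proj (passive_letters \<nu>0) (primal_solution C (\<nu> \<delta>))) \<longlongrightarrow> qp) (at_right 0))
          \<and> (\<exists>q\<in>primal_solutions C \<nu>0.
               ((\<lambda>\<delta>. primal_solution C (\<nu> \<delta>)) \<longlongrightarrow> q) (at_right 0)))"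
proof (intro conjI impI)
  note C = assms(1-4) and \<nu>0 = assms(5)
  have pos: "\<forall>\<^sub>F \<delta> in at_right 0. \<nu> \<delta> \<in> prob_simplex \<and> (\<forall>i. \<nu> \<delta> $ i > 0)"
    using eventually_at_right_less[of "0::real"] by eventually_elim (use assms(6,7) in auto)
  note conv = tendsto_primal_solution[OF C \<nu>0 assms(8) pos]
  let ?S = "primal_solutions C \<nu>0"
  have S: "?S \<noteq> {}"
    using primal_solutions_nonempty[OF C \<nu>0 _ assms(8) pos] by simp
  show "epi_converges_at_right_0 (\<lambda>\<delta>. restrict_top C (ell (\<nu> \<delta>))) (restrict_top C (ell \<nu>0))"
    unfolding epi_converges_at_right_0_def
  proof (intro allI impI epi_converges_restrict_ell C \<nu>0)
    fix \<delta> :: "nat \<Rightarrow> real" assume \<delta>: "(\<forall>n. \<delta> n > 0) \<and> decseq \<delta> \<and> \<delta> \<longlonglongrightarrow> 0"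
    then have "filterlim \<delta> (at_right 0) sequentially" by (intro tendsto_imp_filterlim_at_right) auto
    with assms(8) show "(\<lambda>n. \<nu> (\<delta> n)) \<longlonglongrightarrow> \<nu>0" by (rule filterlim_compose)
    show "\<nu> (\<delta> n) \<in> prob_simplex" for n using assms(6) \<delta> by blast
  qed
  have "((\<lambda>\<delta>. infdist (primal_solution C (\<nu> \<delta>)) ?S) \<longlongrightarrow> 0) (at_right 0)"
    by (rule conv) (auto intro: continuous_intros)
  then show "((\<lambda>\<delta>. INF q\<in>?S. dist (primal_solution C (\<nu> \<delta>)) q) \<longlongrightarrow> (0::real)) (at_right 0)"
    using S by (simp add: infdist_def)
  obtain s where s: "s \<in> ?S" using S by blast
  have active: "coord_proj (active_letters \<nu>0) q = coord_proj (active_letters \<nu>0) s" if "q \<in> ?S" for q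
  proof -
    have "q $ i = s $ i" if "\<nu>0 $ i > 0" for i
      using primal_solutions_active_unique[OF C(1) prob_simplex_nonneg[OF \<nu>0] \<open>q \<in> ?S\<close> s _ that]
        primal_solutions_ell_finite[OF C(1,3,4) \<open>q \<in> ?S\<close>] by blast
    then show ?thesis by (simp add: coord_proj_def active_letters_def vec_eq_iff)
  qed
  show "\<exists>qa. coord_proj (active_letters \<nu>0) ` ?S = {qa}
      \<and> ((\<lambda>\<delta>. coord_proj (active_letters \<nu>0) (primal_solution C (\<nu> \<delta>))) \<longlongrightarrow> qa) (at_right 0)"
  proof (intro exI conjI)
    show "coord_proj (active_letters \<nu>0) ` ?S = {coord_proj (active_letters \<nu>0) s}"
      by (subst image_cong[OF refl active]) (use s in auto)
    show "((\<lambda>\<delta>. coord_proj (active_letters \<nu>0) (primal_solution C (\<nu> \<delta>)))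
        \<longlongrightarrow> coord_proj (active_letters \<nu>0) s) (at_right 0)"
      by (rule conv[OF continuous_on_coord_proj active])
  qed
  show "is_singleton ?S" if "\<forall>i. \<nu>0 $ i > 0"
    using ex1_primal_solution[OF C, of \<nu>0] that by (auto simp: is_singleton_def)
  assume "is_singleton ?S"
  then have single: "q = s" if "q \<in> ?S" for q using s that by (auto simp: is_singleton_def)
  show "\<exists>qp. ((\<lambda>\<delta>. coord_proj (passive_letters \<nu>0) (primal_solution C (\<nu> \<delta>))) \<longlongrightarrow> qp) (at_right 0)"
    using conv[OF continuous_on_coord_proj] single by metis
  show "\<exists>q\<in>?S. ((\<lambda>\<delta>. primal_solution C (\<nu> \<delta>)) \<longlongrightarrow> q) (at_right 0)"
    using conv[OF continuous_on_id single] s by blast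
qed

end
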